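(* Let $\Omega\subset\mathbb R^d$ be a regular set with $\mu_d(\Omega)>0$ and let $f:\Omega\to\mathbb R$ be measurable. Let $[\boldsymbol a,\boldsymbol b]$ be any $d$-dimensional rectangle containing $\Omega$. Then there exists an asymptotically uniform grid $\mathcal G_{\boldsymbol n}=\{\boldsymbol x_{\boldsymbol i,\boldsymbol n}\}_{\boldsymbol i=\mathbf 1,\ldots,\boldsymbol n}$ ($\boldsymbol n\in\mathbb N^d$) in $[\boldsymbol a,\boldsymbol b]$ with the following property. For each $\boldsymbol n\in\mathbb N^d$, consider the samples $f(\boldsymbol x_{\boldsymbol i,\boldsymbol n})$ for $\boldsymbol i\in\mathcal I_{\boldsymbol n}(\Omega)=\{\boldsymbol i\in\{\mathbf 1,\ldots,\boldsymbol n\}:\boldsymbol x_{\boldsymbol i,\boldsymbol n}\in\Omega\}$, sort them (with multiplicity) in non-decreasing order, and put them into a vector $(s_0,\ldots,s_{\omega(\boldsymbol n)})$, where $\omega(\boldsymbol n)=\#\mathcal I_{\boldsymbol n}(\Omega)-1$. Let $f^\dag_{\boldsymbol n}:[0,1]\to\mathbb R$ be the linear spline function that interpolates the samples $(s_0,\ldots,s_{\omega(\boldsymbol n)})$ over the equally spaced nodes $(0,\frac1{\omega(\boldsymbol n)},\frac2{\omega(\boldsymbol n)},\ldots,1)$ in $[0,1]$. Then $f^\dag_{\boldsymbol n}\to f^\dag$ a.e. in $(0,1)$ as $\boldsymbol n\to\infty$.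
   Context: $\mu_d$ is Lebesgue measure in $\mathbb R^d$; all measure-theoretic terms refer to it. $\mathbb N=\{1,2,\ldots\}$. Regular set: $\Omega\subset\mathbb R^d$ is regular if it is bounded and $\mu_d(\partial\Omega)=0$. Monotone rearrangement: for $f:\Omega\to\mathbb R$ measurable with $0<\mu_d(\Omega)<\infty$, $f^\dag:(0,1)\to\mathbb R$ is $f^\dag(y)=\inf\{u\in\mathbb R:\mu_d\{\boldsymbol x\in\Omega:f(\boldsymbol x)\le u\}/\mu_d(\Omega)\ge y\}$. Multi-indices: inequalities and operations (product, quotient) between vectors are componentwise; $\mathbf 1=(1,\ldots,1)$; $\{\mathbf 1,\ldots,\boldsymbol n\}=\{\boldsymbol i\in\mathbb Z^d:\mathbf 1\le\boldsymbol i\le\boldsymbol n\}$; $\boldsymbol n\to\infty$ means $\min_j n_j\to\infty$. Rectangles: for $\boldsymbol a\le\boldsymbol b$ in $\mathbb R^d$, $[\boldsymbol a,\boldsymbol b]=[a_1,b_1]\times\cdots\times[a_d,b_d]$. Asymptotically uniform grid: a family, indexed by $\boldsymbol n\in\mathbb N^d$, of grids $\mathcal G_{\boldsymbol n}=\{\boldsymbol x_{\boldsymbol i,\boldsymbol n}\}_{\boldsymbol i=\mathbf 1,\ldots,\boldsymbol n}$ of points in $\mathbb R^d$ is asymptotically uniform in $[\boldsymbol a,\boldsymbol b]$ if \[ \lim_{\boldsymbol n\to\infty}\max_{\boldsymbol i=\mathbf 1,\ldots,\boldsymbol n}\Bigl\|\boldsymbol x_{\boldsymbol i,\boldsymbol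 n}-\Bigl(\boldsymbol a+\boldsymbol i\,\frac{\boldsymbol b-\boldsymbol a}{\boldsymbol n}\Bigr)\Bigr\|_\infty=0. \] Linear spline: $f^\dag_{\boldsymbol n}(i/\omega(\boldsymbol n))=s_i$ for $i=0,\ldots,\omega(\boldsymbol n)$ and $f^\dag_{\boldsymbol n}$ is affine on each $[\frac i{\omega(\boldsymbol n)},\frac{i+1}{\omega(\boldsymbol n)}]$. It is defined when $\omega(\boldsymbol n)\ge1$, which holds whenever $\min_j n_j$ is sufficiently large; $f^\dag_{\boldsymbol n}$ may be taken arbitrary for the other $\boldsymbol n$. *)

theory Defs
  imports "HOL-Analysis.Analysis" "HOL-Library.Multiset"
begin

definition regular_set :: "(real ^ 'd) set \<Rightarrow> bool" where
  "regular_set \<Omega> \<longleftrightarrow> bounded \<Omega> \<and> frontier \<Omega> \<in> null_sets lebesgue"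

definition monotone_rearrangement ::
    "(real ^ 'd) set \<Rightarrow> (real ^ 'd \<Rightarrow> real) \<Rightarrow> real \<Rightarrow> real" where
  "monotone_rearrangement \<Omega> f y =
     Inf {u. measure lebesgue {x \<in> \<Omega>. f x \<le> u} / measure lebesgue \<Omega> \<ge> y}"

text \<open>
  Multi-indices are elements of \<^typ>\<open>nat ^ 'd\<close>; the order is componentwise and \<open>1\<close> is the all-ones
  vector. The filter below only concerns \<open>n \<ge> 1\<close>, since a vector with a zero component has
  minimum 0.
\<close>

definition multi_at_top :: "(nat ^ 'd) filter" where
  "multi_at_top = filtercomap (\<lambda>n. Min (range (\<lambda>j. n $ j))) at_top"

lemma finite_multi_index_range [simp]: "finite {i :: nat ^ 'd. 1 \<le> i \<and> i \<le> n}"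
proof (rule finite_subset)
  show "{i :: nat ^ 'd. 1 \<le> i \<and> i \<le> n} \<subseteq> vec_lambda ` (UNIV \<rightarrow>\<^sub>E {..Max (range (\<lambda>j. n $ j))})"
  proof
    fix i :: "nat ^ 'd" assume "i \<in> {i. 1 \<le> i \<and> i \<le> n}"
    then have "i $ j \<le> Max (range (\<lambda>j. n $ j))" for j
      by (auto simp: less_eq_vec_def intro: order_trans[OF _ Max_ge])
    then have "vec_nth i \<in> UNIV \<rightarrow>\<^sub>E {..Max (range (\<lambda>j. n $ j))}"
      by auto
    then show "i \<in> vec_lambda ` (UNIV \<rightarrow>\<^sub>E {..Max (range (\<lambda>j. n $ j))})"
      by (metis image_eqI vec_nth_inverse)
  qed
qed (intro finite_imageI finite_PiE; simp)

text \<open>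
  A family of grids is a function \<open>x\<close>, where \<open>x n i\<close> is the point with index \<open>i\<close> of the grid \<open>n\<close>;
  only the values with \<open>1 \<le> i \<le> n\<close> matter. The points are not required to lie in the rectangle.
\<close>

definition asymptotically_uniform ::
    "real ^ 'd \<Rightarrow> real ^ 'd \<Rightarrow> (nat ^ 'd \<Rightarrow> nat ^ 'd \<Rightarrow> real ^ 'd) \<Rightarrow> bool" where
  "asymptotically_uniform a b x \<longleftrightarrow>
     ((\<lambda>n. Max ((\<lambda>i. infnorm (x n i - (\<chi> j. a $ j + real (i $ j) * ((b $ j - a $ j) / real (n $ j)))))
                  ` {i. 1 \<le> i \<and> i \<le> n}))
        \<longlongrightarrow> 0) multi_at_top"

definition grid_indices_in ::
    "(real ^ 'd) set \<Rightarrow> (nat ^ 'd \<Rightarrow> nat ^ 'd \<Rightarrow> real ^ 'd) \<Rightarrow> nat ^ 'd \<Rightarrow> (nat ^ 'd) set" where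
  "grid_indices_in \<Omega> x n = {i. 1 \<le> i \<and> i \<le> n \<and> x n i \<in> \<Omega>}"

text \<open>Truncated subtraction: the value is 0 (not -1) if no grid point lies in \<open>\<Omega>\<close>.\<close>

definition grid_omega ::
    "(real ^ 'd) set \<Rightarrow> (nat ^ 'd \<Rightarrow> nat ^ 'd \<Rightarrow> real ^ 'd) \<Rightarrow> nat ^ 'd \<Rightarrow> nat" where
  "grid_omega \<Omega> x n = card (grid_indices_in \<Omega> x n) - 1"

definition sorted_samples ::
    "(real ^ 'd) set \<Rightarrow> (real ^ 'd \<Rightarrow> real) \<Rightarrow> (nat ^ 'd \<Rightarrow> nat ^ 'd \<Rightarrow> real ^ 'd) \<Rightarrow> nat ^ 'd
      \<Rightarrow> real list" where
  "sorted_samples \<Omega> f x n =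
     sorted_list_of_multiset (image_mset (\<lambda>i. f (x n i)) (mset_set (grid_indices_in \<Omega> x n)))"

text \<open>
  For \<open>w \<ge> 1\<close> this determines \<open>g\<close> uniquely on \<open>[0,1]\<close>; the values elsewhere are unconstrained.
\<close>

definition is_linear_spline :: "nat \<Rightarrow> (nat \<Rightarrow> real) \<Rightarrow> (real \<Rightarrow> real) \<Rightarrow> bool" where
  "is_linear_spline w s g \<longleftrightarrow>
     (\<forall>i\<le>w. g (real i / real w) = s i) \<and>
     (\<forall>i<w. \<exists>m c. \<forall>y\<in>{real i / real w..real (i + 1) / real w}. g y = m * y + c)"

end

theory Submission
  imports Defs
begin

text \<open>
  Cut the rectangle into \<open>N\<close> half-open cells of equal volume and put one grid point into each. For
  fixed sets \<open>A 0, A 1, \<dots>\<close> the points can be chosen such that for each \<open>k < Min n\<close> the number in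
  \<open>A k\<close> differs from its average \<open>N \<mu>(A k) / \<mu>([a, b])\<close> by at most \<open>sqrt (2 ^ (k + 1) N)\<close>. For \<open>\<Omega>\<close> and
  its sublevel sets \<open>f \<le> u\<close> with rational \<open>u\<close>, this makes the empirical distribution function of the
  samples converge at every rational to the distribution function of \<open>f\<close>. The sorted samples then
  converge to the quantile function wherever the latter is continuous, that is, outside a
  countable set.
\<close>

section \<open>Choice of one point per cell with small discrepancy\<close>

text \<open>The subtracted fraction is the average of \<open>indicator (A j)\<close> over
  \<open>Q\<close>, so the weighted sum has integral zero over \<open>Q\<close> whatever the signs
  of \<open>c\<close>. A function that is positive throughout a set of positive measure cannot have
  integral zero there.\<close>

lemma exists_nonpos_weighted_deviation:
  fixes c :: "'j \<Rightarrow> real" and A :: "'j \<Rightarrow> 'a set"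
  assumes Q: "Q \<in> fmeasurable M" "measure M Q > 0" and A: "\<And>j. j \<in> J \<Longrightarrow> A j \<in> sets M"
  shows "\<exists>x\<in>Q. (\<Sum>j\<in>J. c j * (indicator (A j) x - measure M (A j \<inter> Q) / measure M Q)) \<le> 0"
proof (rule ccontr)
  let ?p = "\<lambda>j. measure M (A j \<inter> Q) / measure M Q"
  let ?g = "\<lambda>x. \<Sum>j\<in>J. c j * (indicator (A j \<inter> Q) x - ?p j * indicator Q x)"
  assume "\<not> ?thesis"
  \<comment> \<open>\<open>?g\<close> is the weighted deviation cut off to zero outside
    \<open>Q\<close>; under the negated claim it is nonnegative everywhere and positive on
    \<open>Q\<close>.\<close>
  moreover have g_eq: "?g x = indicator Q x * (\<Sum>j\<in>J. c j * (indicator (A j) x - ?p j))" for x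
    by (auto simp: indicator_def)
  ultimately have g_pos: "?g x > 0" if "x \<in> Q" for x
    using that unfolding g_eq by (auto simp: not_le)
  have g_nonneg: "?g x \<ge> 0" for x
    using g_pos[of x] by (cases "x \<in> Q") (auto simp: g_eq)
  have AQ: "A j \<inter> Q \<in> fmeasurable M" if "j \<in> J" for j
    using fmeasurable_Int_fmeasurable[OF Q(1) A[OF that]] by (simp add: Int_commute)
  have int: "integrable M (indicat_real Q)" "j \<in> J \<Longrightarrow> integrable M (indicat_real (A j \<inter> Q))" for j
    using Q(1) AQ by (auto simp: fmeasurable_def)
  have "integral\<^sup>L M ?g = (\<Sum>j\<in>J. c j * (measure M (A j \<inter> Q) - ?p j * measure M Q))"
  proof (subst Bochner_Integration.integral_sum)
    show "integrable M (\<lambda>x. c j * (indicator (A j \<inter> Q) x - ?p j * indicator Q x))" if "j \<in> J" for j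
      using int that by (intro integrable_mult_right Bochner_Integration.integrable_diff) auto
    show "(\<Sum>j\<in>J. LINT x|M. c j * (indicat_real (A j \<inter> Q) x - ?p j * indicat_real Q x)) =
       (\<Sum>j\<in>J. c j * (measure M (A j \<inter> Q) - ?p j * measure M Q))"
    proof (rule sum.cong[OF refl])
      fix j assume j: "j \<in> J"
      have "(LINT x|M. indicat_real (A j \<inter> Q) x - ?p j * indicat_real Q x) =
        (LINT x|M. indicat_real (A j \<inter> Q) x) - (LINT x|M. ?p j * indicat_real Q x)"
        using int j by (intro Bochner_Integration.integral_diff) auto
      also have "\<dots> = measure M (A j \<inter> Q) - ?p j * measure M Q"
        using sets.sets_into_space[OF fmeasurableD[OF Q(1)]] sets.sets_into_space[OF A[OF j]]
        by (simp add: Int_absorb2 Int_assoc)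
      finally show "(LINT x|M. c j * (indicat_real (A j \<inter> Q) x - ?p j * indicat_real Q x)) =
         c j * (measure M (A j \<inter> Q) - ?p j * measure M Q)"
        by simp
    qed
  qed
  also have "\<dots> = 0"
    using Q(2) by simp
  finally have "integral\<^sup>L M ?g = 0" .
  moreover have "integrable M ?g"
    using int
    by (intro Bochner_Integration.integrable_sum integrable_mult_right Bochner_Integration.integrable_diff) auto
  ultimately have "AE x in M. ?g x = 0"
    using integral_nonneg_eq_0_iff_AE[of M ?g] g_nonneg by blast
  then have "AE x in M. x \<notin> Q"
    by (rule eventually_mono) (use g_pos in force)
  then have "Q \<in> null_sets M"
    using Q(1) by (metis AE_iff_null_sets fmeasurableD)
  then show False
    using Q(2) by (auto simp: null_sets_def measure_def)
qed

text \<open>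
  A derandomised second-moment bound: visiting the cells one by one, the new point is chosen so that
  its increment has non-positive inner product with the discrepancy vector accumulated so far, so
  each cell adds at most \<open>\<Sum>j\<in>J. w j\<close> to the squared norm.
\<close>

lemma exists_low_discrepancy_selection:
  fixes w :: "'j \<Rightarrow> real" and A :: "'j \<Rightarrow> 'a set" and Q :: "'i \<Rightarrow> 'a set"
  assumes "finite I" and Q: "\<And>i. i \<in> I \<Longrightarrow> Q i \<in> fmeasurable M" "\<And>i. i \<in> I \<Longrightarrow> measure M (Q i) > 0"
    and A: "\<And>j. j \<in> J \<Longrightarrow> A j \<in> sets M" and w: "\<And>j. j \<in> J \<Longrightarrow> w j \<ge> 0"
  shows "\<exists>x. (\<forall>i\<in>I. x i \<in> Q i) \<and>
    (\<Sum>j\<in>J. w j * (\<Sum>i\<in>I. indicator (A j) (x i) - measure M (A j \<inter> Q i) / measure M (Q i))\<^sup>2)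
      \<le> (\<Sum>j\<in>J. w j) * real (card I)"
  using assms(1) Q
proof (induction I rule: finite_induct)
  case empty
  then show ?case by simp
next
  case (insert k I)
  let ?p = "\<lambda>j i. measure M (A j \<inter> Q i) / measure M (Q i)"
  obtain x where x: "\<forall>i\<in>I. x i \<in> Q i"
      "(\<Sum>j\<in>J. w j * (\<Sum>i\<in>I. indicator (A j) (x i) - ?p j i)\<^sup>2) \<le> (\<Sum>j\<in>J. w j) * real (card I)"
    using insert by blast
  define S where "S j = (\<Sum>i\<in>I. indicator (A j) (x i) - ?p j i)" for j
  \<comment> \<open>With the coefficients \<open>w j * S j\<close> the sum is half the cross term in
    the expansion of the new squared norm, so this choice of \<open>z\<close> makes the cross term
    nonpositive.\<close>
  obtain z where z: "z \<in> Q k" "(\<Sum>j\<in>J. w j * S j * (indicator (A j) z - ?p j k)) \<le> 0"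
    using exists_nonpos_weighted_deviation[where c = "\<lambda>j. w j * S j" and J = J and A = A and M = M and Q = "Q k"]
      insert.prems A by auto
  define y where "y = x(k := z)"
  have S_y: "(\<Sum>i\<in>I. indicator (A j) (y i) - ?p j i) = S j" for j
    unfolding S_def y_def using insert.hyps by (intro sum.cong) auto
  have p01: "0 \<le> ?p j k \<and> ?p j k \<le> 1" if "j \<in> J" for j
  proof -
    have "measure M (A j \<inter> Q k) \<le> measure M (Q k)"
      using insert.prems(1)[of k] A[OF that]
      by (intro measure_mono_fmeasurable) auto
    then show ?thesis
      using insert.prems(2)[of k] by simp
  qed
  have inc: "(indicator (A j) z - ?p j k)\<^sup>2 \<le> 1" if "j \<in> J" for j
    using p01[OF that] by (auto simp: indicator_def abs_square_le_1)
  have "(\<Sum>j\<in>J. w j * (\<Sum>i\<in>insert k I. indicator (A j) (y i) - ?p j i)\<^sup>2)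
      = (\<Sum>j\<in>J. w j * ((indicator (A j) z - ?p j k) + S j)\<^sup>2)"
    using insert.hyps S_y by (simp add: y_def)
  also have "\<dots> = (\<Sum>j\<in>J. w j * (indicator (A j) z - ?p j k)\<^sup>2)
      + 2 * (\<Sum>j\<in>J. w j * S j * (indicator (A j) z - ?p j k)) + (\<Sum>j\<in>J. w j * (S j)\<^sup>2)"
    unfolding sum_distrib_left sum.distrib[symmetric]
    by (intro sum.cong refl) algebra
  also have "\<dots> \<le> (\<Sum>j\<in>J. w j) + 2 * 0 + (\<Sum>j\<in>J. w j) * real (card I)"
    using x(2) z(2) w inc
    by (intro add_mono mult_left_mono sum_mono) (auto simp: S_def intro: mult_left_le)
  also have "\<dots> = (\<Sum>j\<in>J. w j) * real (card (insert k I))"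
    using insert.hyps by (simp add: algebra_simps)
  finally have "(\<Sum>j\<in>J. w j * (\<Sum>i\<in>insert k I. indicator (A j) (y i) - ?p j i)\<^sup>2)
      \<le> (\<Sum>j\<in>J. w j) * real (card (insert k I))" .
  moreover have "\<forall>i\<in>insert k I. y i \<in> Q i"
    using x(1) z(1) insert.hyps by (auto simp: y_def)
  ultimately show ?case by blast
qed

section \<open>The partition of the rectangle into cells\<close>

text \<open>Half-open cells are pairwise disjoint, and the upper corner of cell \<open>i\<close> is
  the exact uniform grid point with which asymptotic uniformity compares. The subtraction of 1 takes
  place in the reals, so it is not truncated.\<close>

definition grid_cell :: "real ^ 'd \<Rightarrow> real ^ 'd \<Rightarrow> nat ^ 'd \<Rightarrow> nat ^ 'd \<Rightarrow> (real ^ 'd) set" where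
  "grid_cell a b n i = {x. \<forall>j. a $ j + (real (i $ j) - 1) * ((b $ j - a $ j) / real (n $ j)) < x $ j \<and>
     x $ j \<le> a $ j + real (i $ j) * ((b $ j - a $ j) / real (n $ j))}"

lemma multi_index_le_iff: "1 \<le> (i :: nat ^ 'd) \<and> i \<le> n \<longleftrightarrow> (\<forall>j. 1 \<le> i $ j \<and> i $ j \<le> n $ j)"
  by (auto simp: less_eq_vec_def)

lemma measure_cbox_pos:
  fixes a b :: "real ^ 'd"
  assumes "\<And>j. a $ j < b $ j"
  shows "measure lebesgue (cbox a b) > 0"
  using assms by (auto simp: content_cbox_if_cart interval_eq_empty_cart not_less less_imp_le intro!: prod_pos)

context
  fixes a b :: "real ^ 'd" and n :: "nat ^ 'd"
  assumes ab: "\<And>j. a $ j < b $ j" and n: "\<And>j. 1 \<le> n $ j"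
begin

lemma lmeasurable_grid_cell: "grid_cell a b n i \<in> lmeasurable"
  and measure_grid_cell:
    "measure lebesgue (grid_cell a b n i) = measure lebesgue (cbox a b) / (\<Prod>j\<in>UNIV. real (n $ j))"
proof -
  define h where "h j = (b $ j - a $ j) / real (n $ j)" for j
  have h: "h j > 0" for j
    using ab[of j] n[of j] by (simp add: h_def)
  define l u where "l = (\<chi> j. a $ j + (real (i $ j) - 1) * h j)" and "u = (\<chi> j. a $ j + real (i $ j) * h j)"
  have "box l u \<subseteq> grid_cell a b n i" "grid_cell a b n i \<subseteq> cbox l u"
    by (auto simp: grid_cell_def mem_box_cart l_def u_def h_def less_imp_le)
  \<comment> \<open>The cell lies between the open and the closed box with the same corners, so it
    differs from the closed one only by part of a null boundary.\<close>
  then have neg: "negligible (cbox l u - grid_cell a b n i \<union> (grid_cell a b n i - cbox l u))"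
    by (intro negligible_subset[OF negligible_frontier_interval[of l u]]) auto
  show "grid_cell a b n i \<in> lmeasurable"
    by (rule lmeasurable_negligible_symdiff[OF _ neg]) simp
  have "measure lebesgue (grid_cell a b n i) = measure lebesgue (cbox l u)"
    by (rule measure_negligible_symdiff[OF _ neg]) simp
  also have "\<dots> = (\<Prod>j\<in>UNIV. u $ j - l $ j)"
    using h by (simp add: content_cbox_if_cart interval_eq_empty_cart l_def u_def algebra_simps)
      (meson less_le_not_le)
  also have "\<dots> = (\<Prod>j\<in>UNIV. h j)"
    by (simp add: l_def u_def algebra_simps)
  also have "\<dots> = (\<Prod>j\<in>UNIV. b $ j - a $ j) / (\<Prod>j\<in>UNIV. real (n $ j))"
    unfolding h_def by (rule prod_dividef)
  also have "(\<Prod>j\<in>UNIV. b $ j - a $ j) = measure lebesgue (cbox a b)"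
    using ab by (simp add: content_cbox_if_cart interval_eq_empty_cart) (meson less_le_not_le)
  finally show "measure lebesgue (grid_cell a b n i)
    = measure lebesgue (cbox a b) / (\<Prod>j\<in>UNIV. real (n $ j))" .
qed

lemma disjnt_grid_cell:
  assumes "i \<noteq> k"
  shows "disjnt (grid_cell a b n i) (grid_cell a b n k)"
proof -
  have False if x: "x \<in> grid_cell a b n i" "x \<in> grid_cell a b n k" for x
  proof -
    \<comment> \<open>Comparing the lower face of one cell with the upper face of the other gives
      \<open>r $ j - 1 < s $ j\<close> over the reals, hence \<open>r $ j \<le> s $ j\<close> for
      integers; exchanging the cells yields equality.\<close>
    have le: "r $ j \<le> s $ j" if r: "x \<in> grid_cell a b n r" and s: "x \<in> grid_cell a b n s" for r s j
    proof -
      have "a $ j + (real (r $ j) - 1) * ((b $ j - a $ j) / real (n $ j))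
          < a $ j + real (s $ j) * ((b $ j - a $ j) / real (n $ j))"
        by (rule less_le_trans[of _ "x $ j"]) (use r s in \<open>simp_all only: grid_cell_def mem_Collect_eq\<close>)
      moreover have "(b $ j - a $ j) / real (n $ j) > 0"
        using ab[of j] n[of j] by simp
      ultimately have "real (r $ j) - 1 < real (s $ j)"
        by (metis add_less_cancel_left mult_less_cancel_right_pos)
      then show ?thesis by linarith
    qed
    have "i = k"
      using le[OF x] le[OF x(2,1)] by (simp add: vec_eq_iff antisym)
    with assms show False by simp
  qed
  then show ?thesis
    by (auto simp: disjnt_def)
qed

text \<open>The half-open cells miss the lower faces of \<open>cbox a b\<close>. Covering the open
  box suffices, because the boundary is a null set.\<close>

lemma box_subset_UN_grid_cell: "box a b \<subseteq> (\<Union>i\<in>{i. 1 \<le> i \<and> i \<le> n}. grid_cell a b n i)"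
proof
  fix x assume x: "x \<in> box a b"
  define h where "h j = (b $ j - a $ j) / real (n $ j)" for j
  have h: "h j > 0" for j
    using ab[of j] n[of j] by (simp add: h_def)
  define t where "t j = (x $ j - a $ j) / h j" for j
  have t: "0 < t j" "t j \<le> real (n $ j)" for j
    using x ab[of j] n[of j] by (auto simp: t_def h_def mem_box_cart field_simps less_imp_le)
  \<comment> \<open>The ceiling is the integer with \<open>i $ j - 1 < t j \<le> i $ j\<close>,
    which matches the half-open shape of the cells.\<close>
  define i :: "nat ^ 'd" where "i = (\<chi> j. nat \<lceil>t j\<rceil>)"
  have i: "real (i $ j) = of_int \<lceil>t j\<rceil>" for j
    using t(1)[of j] by (simp add: i_def)
  have bnd: "real (i $ j) - 1 < t j" "t j \<le> real (i $ j)" for j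
    unfolding i by linarith+
  have "x $ j = a $ j + t j * h j" for j
    using h[of j] by (simp add: t_def)
  then have "x \<in> grid_cell a b n i"
    using bnd h unfolding grid_cell_def h_def[symmetric] by (simp add: less_imp_le)
  moreover have "1 \<le> i $ j \<and> i $ j \<le> n $ j" for j
    using t[of j] by (simp add: i_def nat_le_iff ceiling_le_iff) linarith
  ultimately show "x \<in> (\<Union>i\<in>{i. 1 \<le> i \<and> i \<le> n}. grid_cell a b n i)"
    using multi_index_le_iff by blast
qed

text \<open>The cells are disjoint, and the part of \<open>A\<close> that they miss lies on the
  boundary of the rectangle.\<close>

lemma sum_measure_Int_grid_cell:
  assumes A: "A \<in> sets lebesgue" "A \<subseteq> cbox a b"
  shows "(\<Sum>i\<in>{i. 1 \<le> i \<and> i \<le> n}. measure lebesgue (A \<inter> grid_cell a b n i)) = measure lebesgue A"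
proof -
  let ?I = "{i. 1 \<le> i \<and> i \<le> n}"
  have Am: "A \<in> lmeasurable"
    using A by (metis bounded_cbox bounded_set_imp_lmeasurable bounded_subset)
  have "(\<Sum>i\<in>?I. measure lebesgue (A \<inter> grid_cell a b n i)) = measure lebesgue (\<Union>i\<in>?I. A \<inter> grid_cell a b n i)"
  proof (rule measure_UNION'[symmetric])
    show "pairwise (\<lambda>i k. disjnt (A \<inter> grid_cell a b n i) (A \<inter> grid_cell a b n k)) ?I"
      using disjnt_grid_cell by (fastforce simp: pairwise_def disjnt_def)
  qed (use Am lmeasurable_grid_cell in \<open>auto intro: fmeasurable.Int\<close>)
  also have "\<dots> = measure lebesgue A"
  proof (rule measure_negligible_symdiff[OF Am])
    show "negligible (A - (\<Union>i\<in>?I. A \<inter> grid_cell a b n i) \<union> ((\<Union>i\<in>?I. A \<inter> grid_cell a b n i) - A))"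
      using box_subset_UN_grid_cell A(2)
      by (intro negligible_subset[OF negligible_frontier_interval[of a b]]) auto
  qed
  finally show ?thesis .
qed

text \<open>The compared point is the upper corner of the cell, so each coordinate is off by at most
  the side length \<open>(b $ j - a $ j) / real (n $ j)\<close>.\<close>

lemma infnorm_grid_cell_le:
  assumes x: "x \<in> grid_cell a b n i"
  shows "infnorm (x - (\<chi> j. a $ j + real (i $ j) * ((b $ j - a $ j) / real (n $ j))))
    \<le> infnorm (b - a) / real (Min (range (\<lambda>j. n $ j)))"
  unfolding infnorm_cart[of "x - _"]
proof (rule cSup_least)
  fix y assume "y \<in> {\<bar>(x - (\<chi> j. a $ j + real (i $ j) * ((b $ j - a $ j) / real (n $ j)))) $ j\<bar> |j. j \<in> UNIV}"
  then obtain j where j: "y = \<bar>x $ j - (a $ j + real (i $ j) * ((b $ j - a $ j) / real (n $ j)))\<bar>"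
    by auto
  let ?m = "Min (range (\<lambda>j. n $ j))"
  define h where "h = (b $ j - a $ j) / real (n $ j)"
  have "a $ j + (real (i $ j) - 1) * h < x $ j" "x $ j \<le> a $ j + real (i $ j) * h"
    using x by (auto simp: grid_cell_def h_def)
  then have "\<bar>x $ j - (a $ j + real (i $ j) * h)\<bar> \<le> h"
    by (simp add: algebra_simps)
  also have "h \<le> infnorm (b - a) / real ?m"
    unfolding h_def
  proof (rule frac_le)
    show "b $ j - a $ j \<le> infnorm (b - a)"
      using component_le_infnorm_cart[of "b - a" j] by simp
    show "0 < real ?m" "real ?m \<le> real (n $ j)"
      using n by (auto simp: Min_gr_iff Suc_le_eq)
  qed (simp add: infnorm_pos_le)
  finally show "y \<le> infnorm (b - a) / real ?m"
    by (simp add: h_def j)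
qed auto

end

text \<open>Counting by volume: the unit cube is, up to a null set, the disjoint union of the cells,
  each of volume \<open>?V / ?P\<close>, so there must be \<open>?P\<close> of them.\<close>

lemma card_multi_index:
  fixes n :: "nat ^ 'd"
  assumes n: "\<And>j. 1 \<le> n $ j"
  shows "real (card {i :: nat ^ 'd. 1 \<le> i \<and> i \<le> n}) = (\<Prod>j\<in>UNIV. real (n $ j))"
proof -
  define a b :: "real ^ 'd" where "a = 0" and "b = 1"
  have ab: "a $ j < b $ j" for j
    by (simp add: a_def b_def)
  let ?I = "{i :: nat ^ 'd. 1 \<le> i \<and> i \<le> n}" and ?P = "\<Prod>j\<in>UNIV. real (n $ j)"
  let ?V = "measure lebesgue (cbox a b)"
  have "grid_cell a b n i \<subseteq> cbox a b" if "i \<in> ?I" for i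
  proof
    fix x assume x: "x \<in> grid_cell a b n i"
    have "a $ j \<le> x $ j \<and> x $ j \<le> b $ j" for j
    proof -
      define h where "h = (b $ j - a $ j) / real (n $ j)"
      have h: "h > 0" "b $ j = a $ j + real (n $ j) * h"
        using ab[of j] n[of j] by (simp_all add: h_def)
      have ij: "1 \<le> i $ j" "i $ j \<le> n $ j"
        using that multi_index_le_iff[of i n] by auto
      have "(real (i $ j) - 1) * h \<ge> 0" "real (i $ j) * h \<le> real (n $ j) * h"
        using h(1) ij by auto
      moreover have "a $ j + (real (i $ j) - 1) * h < x $ j" "x $ j \<le> a $ j + real (i $ j) * h"
        using x by (auto simp: grid_cell_def h_def)
      ultimately show ?thesis
        unfolding h(2) by linarith
    qed
    then show "x \<in> cbox a b"
      by (simp add: mem_box_cart)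
  qed
  then have "(\<Sum>i\<in>?I. measure lebesgue (cbox a b \<inter> grid_cell a b n i)) = real (card ?I) * (?V / ?P)"
    by (simp add: Int_absorb1 measure_grid_cell[OF ab n])
  moreover have "(\<Sum>i\<in>?I. measure lebesgue (cbox a b \<inter> grid_cell a b n i)) = ?V"
    by (rule sum_measure_Int_grid_cell[OF ab n]) auto
  ultimately have "real (card ?I) * (?V / ?P) = ?V"
    by (rule subst)
  moreover have "?P > 0"
    using n by (intro prod_pos) (auto simp: Suc_le_eq)
  moreover have "c = p" if "c * (v / p) = v" "p > 0" "v > 0" for c p v :: real
    using that by (simp add: field_simps)
  ultimately show ?thesis
    using measure_cbox_pos[OF ab] by blast
qed

section \<open>Multi-indices tending to infinity\<close>

lemma filterlim_Min_multi_at_top: "filterlim (\<lambda>n :: nat ^ 'd. Min (range (\<lambda>j. n $ j))) at_top multi_at_top"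
  unfolding multi_at_top_def by (rule filterlim_filtercomap)

lemma eventually_Min_ge_multi_at_top: "\<forall>\<^sub>F n :: nat ^ 'd in multi_at_top. k \<le> Min (range (\<lambda>j. n $ j))"
  using filterlim_Min_multi_at_top unfolding filterlim_at_top by blast

lemma eventually_ge_1_multi_at_top: "\<forall>\<^sub>F n :: nat ^ 'd in multi_at_top. \<forall>j. 1 \<le> n $ j"
  by (rule eventually_mono[OF eventually_Min_ge_multi_at_top[of 1]]) simp

text \<open>All factors of the product are at least 1, so no single component exceeds it. This makes
  the number of cells tend to infinity.\<close>

lemma Min_le_card_multi_index:
  assumes n: "\<And>j. 1 \<le> n $ j"
  shows "Min (range (\<lambda>j. n $ j)) \<le> card {i :: nat ^ 'd. 1 \<le> i \<and> i \<le> n}"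
proof -
  obtain j where "Min (range (\<lambda>j. n $ j)) = n $ j"
    using Min_in[of "range (\<lambda>j. n $ j)"] by (metis UNIV_not_empty finite finite_imageI image_is_empty rangeE)
  also have "real (n $ j) \<le> (\<Prod>k\<in>UNIV. real (n $ k))"
    using n by (subst prod.remove[of _ j]) (auto intro!: mult_right_le_one_le prod_ge_1 simp: mult_le_cancel_left1)
  also have "\<dots> = real (card {i :: nat ^ 'd. 1 \<le> i \<and> i \<le> n})"
    by (rule card_multi_index[symmetric, OF n])
  finally show ?thesis by simp
qed

lemma filterlim_card_multi_index:
  "filterlim (\<lambda>n. card {i :: nat ^ 'd. 1 \<le> i \<and> i \<le> n}) at_top multi_at_top"
  by (rule filterlim_at_top_mono[OF filterlim_Min_multi_at_top])
    (auto intro: eventually_mono[OF eventually_ge_1_multi_at_top] Min_le_card_multi_index)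

section \<open>Construction of the equidistributed grid\<close>

text \<open>Geometric weights have total at most 2, so the selection bound does not grow with the
  number of sets controlled. Each fixed \<open>k\<close> eventually satisfies
  \<open>k < ?m n\<close>, and its discrepancy is then of order at most \<open>sqrt (?N n)\<close>,
  which is negligible against \<open>?N n\<close>.\<close>

lemma exists_equidistributed_grid:
  fixes a b :: "real ^ 'd" and A :: "nat \<Rightarrow> (real ^ 'd) set"
  assumes ab: "\<And>j. a $ j < b $ j" and A: "\<And>k. A k \<in> sets lebesgue" "\<And>k. A k \<subseteq> cbox a b"
  obtains x where "asymptotically_uniform a b x"
    and "\<And>k. ((\<lambda>n. real (card {i. 1 \<le> i \<and> i \<le> n \<and> x n i \<in> A k}) / real (card {i :: nat ^ 'd. 1 \<le> i \<and> i \<le> n}))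
           \<longlongrightarrow> measure lebesgue (A k) / measure lebesgue (cbox a b)) multi_at_top"
proof -
  let ?I = "\<lambda>n. {i :: nat ^ 'd. 1 \<le> i \<and> i \<le> n}"
  let ?N = "\<lambda>n. real (card (?I n))"
  let ?m = "\<lambda>n :: nat ^ 'd. Min (range (\<lambda>j. n $ j))"
  let ?V = "measure lebesgue (cbox a b)"
  let ?p = "\<lambda>k n i. measure lebesgue (A k \<inter> grid_cell a b n i) / measure lebesgue (grid_cell a b n i)"
  have V: "?V > 0"
    using measure_cbox_pos[OF ab] .
  have ex: "\<exists>y. (\<forall>i\<in>?I n. y i \<in> grid_cell a b n i) \<and>
      (\<Sum>k<?m n. (1/2)^k * (\<Sum>i\<in>?I n. indicator (A k) (y i) - ?p k n i)\<^sup>2) \<le> 2 * ?N n"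
    if n: "\<forall>j. 1 \<le> n $ j" for n
  proof -
    have cell: "measure lebesgue (grid_cell a b n i) > 0" for i
      using n V by (subst measure_grid_cell[OF ab]) (auto intro!: divide_pos_pos prod_pos simp: Suc_le_eq)
    obtain y where "\<forall>i\<in>?I n. y i \<in> grid_cell a b n i" and
      y: "(\<Sum>k<?m n. (1/2)^k * (\<Sum>i\<in>?I n. indicator (A k) (y i) - ?p k n i)\<^sup>2) \<le> (\<Sum>k<?m n. (1/2)^k) * ?N n"
      using exists_low_discrepancy_selection[of "?I n" "grid_cell a b n" lebesgue "{..<?m n}" A "\<lambda>k. (1/2)^k"]
        lmeasurable_grid_cell[OF ab] cell A(1) n by auto
    moreover have "(\<Sum>k<?m n. (1/2)^k) \<le> (2 :: real)"
      by (simp add: geometric_sum)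
    then have "(\<Sum>k<?m n. (1/2)^k) * ?N n \<le> 2 * ?N n"
      by (rule mult_right_mono) simp
    ultimately show ?thesis
      using order_trans by blast
  qed
  \<comment> \<open>Each \<open>n\<close> is treated separately. An \<open>n\<close> with a zero
    component is left unconstrained, since the filter eventually avoids it.\<close>
  obtain x where "\<forall>n. (\<forall>j. 1 \<le> n $ j) \<longrightarrow> (\<forall>i\<in>?I n. x n i \<in> grid_cell a b n i) \<and>
      (\<Sum>k<?m n. (1/2)^k * (\<Sum>i\<in>?I n. indicator (A k) (x n i) - ?p k n i)\<^sup>2) \<le> 2 * ?N n"
    by atomize_elim (intro choice allI, use ex in blast)
  then have x_cell: "\<And>n i. \<forall>j. 1 \<le> n $ j \<Longrightarrow> i \<in> ?I n \<Longrightarrow> x n i \<in> grid_cell a b n i"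
    and x_disc: "\<And>n. \<forall>j. 1 \<le> n $ j \<Longrightarrow>
      (\<Sum>k<?m n. (1/2)^k * (\<Sum>i\<in>?I n. indicator (A k) (x n i) - ?p k n i)\<^sup>2) \<le> 2 * ?N n"
    by blast+
  have m_top: "filterlim (\<lambda>n. real (?m n)) at_top multi_at_top"
    using filterlim_compose[OF filterlim_real_sequentially filterlim_Min_multi_at_top] .
  have N_top: "filterlim ?N at_top multi_at_top"
    using filterlim_compose[OF filterlim_real_sequentially filterlim_card_multi_index] .
  have "asymptotically_uniform a b x"
    unfolding asymptotically_uniform_def
  proof (rule tendsto_sandwich[where f = "\<lambda>_. 0"])
    show "((\<lambda>n. infnorm (b - a) / real (?m n)) \<longlongrightarrow> 0) multi_at_top"
      by (rule real_tendsto_divide_at_top[OF tendsto_const m_top])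
    let ?M = "\<lambda>n. Max ((\<lambda>i. infnorm (x n i - (\<chi> j. a $ j + real (i $ j) * ((b $ j - a $ j) / real (n $ j))))) ` ?I n)"
    have "0 \<le> ?M n \<and> ?M n \<le> infnorm (b - a) / real (?m n)" if n: "\<forall>j. 1 \<le> n $ j" for n
    proof -
      have "1 \<in> ?I n"
        using n by (simp add: less_eq_vec_def)
      then have ne: "?I n \<noteq> {}" by blast
      show ?thesis
        using ne infnorm_grid_cell_le[OF ab, of n, OF _ x_cell[OF n]] n
        by (auto simp: Max_ge_iff infnorm_pos_le)
    qed
    then show "\<forall>\<^sub>F n in multi_at_top. 0 \<le> ?M n" "\<forall>\<^sub>F n in multi_at_top. ?M n \<le> infnorm (b - a) / real (?m n)"
      by (auto intro: eventually_mono[OF eventually_ge_1_multi_at_top])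
  qed simp
  moreover have "((\<lambda>n. real (card {i. 1 \<le> i \<and> i \<le> n \<and> x n i \<in> A k}) / ?N n)
      \<longlongrightarrow> measure lebesgue (A k) / ?V) multi_at_top" for k
  proof (rule Lim_transform2[OF tendsto_const])
    let ?c = "\<lambda>n. real (card {i. 1 \<le> i \<and> i \<le> n \<and> x n i \<in> A k})"
    have bound: "norm (measure lebesgue (A k) / ?V - ?c n / ?N n) \<le> sqrt (2 ^ Suc k / ?N n)"
      if n: "\<forall>j. 1 \<le> n $ j" and k: "k < ?m n" for n
    proof -
      have N: "?N n > 0"
        using less_le_trans[OF _ Min_le_card_multi_index[of n], of 0] n k
        by (metis gr_implies_not0 of_nat_0_less_iff neq0_conv)
      define D where "D = (\<Sum>i\<in>?I n. indicator (A k) (x n i) - ?p k n i)"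
      have P: "(\<Prod>j\<in>UNIV. real (n $ j)) = ?N n"
        using card_multi_index[of n] n by simp
      have "D = (\<Sum>i\<in>?I n. indicator (A k) (x n i)) - (\<Sum>i\<in>?I n. ?p k n i)"
        unfolding D_def by (rule sum_subtractf)
      also have "(\<Sum>i\<in>?I n. indicator (A k) (x n i)) = ?c n"
      proof -
        have "{i. 1 \<le> i \<and> i \<le> n \<and> x n i \<in> A k} = {i \<in> ?I n. x n i \<in> A k}" by auto
        then show ?thesis
          by (simp add: indicator_def sum.If_cases Int_def)
      qed
      \<comment> \<open>Equal cell volumes \<open>?V / ?N n\<close> let the averages over the cells
        add up to a multiple of the total measure of \<open>A k\<close>.\<close>
      also have "(\<Sum>i\<in>?I n. ?p k n i) = ?N n * (measure lebesgue (A k) / ?V)"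
      proof -
        have "(\<Sum>i\<in>?I n. ?p k n i) = (\<Sum>i\<in>?I n. measure lebesgue (A k \<inter> grid_cell a b n i)) / (?V / ?N n)"
          unfolding sum_divide_distrib using measure_grid_cell[OF ab, of n] n P by (intro sum.cong) auto
        also have "(\<Sum>i\<in>?I n. measure lebesgue (A k \<inter> grid_cell a b n i)) = measure lebesgue (A k)"
          by (rule sum_measure_Int_grid_cell[OF ab _ A]) (use n in blast)
        finally show ?thesis by simp
      qed
      finally have "D = ?c n - ?N n * (measure lebesgue (A k) / ?V)" .
      then have D: "measure lebesgue (A k) / ?V - ?c n / ?N n = - D / ?N n"
      proof -
        have "r - c / m = - (c - m * r) / m" if "m > 0" for c m r :: real
          using that by (simp add: field_simps)
        then show ?thesis
          using N unfolding \<open>D = ?c n - _\<close> by blast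
      qed
      \<comment> \<open>One term is kept from a sum of nonnegative ones; dividing by its weight
        turns the bound \<open>2 * ?N n\<close> into \<open>2 ^ Suc k * ?N n\<close>.\<close>
      have "(1/2)^k * D\<^sup>2 \<le> (\<Sum>k<?m n. (1/2)^k * (\<Sum>i\<in>?I n. indicator (A k) (x n i) - ?p k n i)\<^sup>2)"
        unfolding D_def using k by (intro member_le_sum) auto
      also have "\<dots> \<le> 2 * ?N n"
        by (rule x_disc[OF n])
      finally have "D\<^sup>2 \<le> 2 ^ Suc k * ?N n"
        by (simp add: field_simps power_one_over)
      then have "(D / ?N n)\<^sup>2 \<le> 2 ^ Suc k / ?N n"
      proof -
        have "(s / m)\<^sup>2 \<le> t / m" if "m > 0" "s\<^sup>2 \<le> t * m" for s t m :: real
          using that by (simp add: field_simps power2_eq_square)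
        then show ?thesis
          using N \<open>D\<^sup>2 \<le> _\<close> by blast
      qed
      then have "\<bar>D / ?N n\<bar> \<le> sqrt (2 ^ Suc k / ?N n)"
        by (intro real_le_rsqrt) (simp only: power2_abs)
      then show ?thesis
        unfolding D by simp
    qed
    have "((\<lambda>n. sqrt (2 ^ Suc k / ?N n)) \<longlongrightarrow> sqrt 0) multi_at_top"
      by (intro tendsto_real_sqrt real_tendsto_divide_at_top[OF tendsto_const N_top])
    then have "((\<lambda>n. sqrt (2 ^ Suc k / ?N n)) \<longlongrightarrow> 0) multi_at_top"
      by simp
    then show "((\<lambda>n. measure lebesgue (A k) / ?V - ?c n / ?N n) \<longlongrightarrow> 0) multi_at_top"
      by (rule Lim_null_comparison[rotated])
        (use eventually_conj[OF eventually_ge_1_multi_at_top eventually_Min_ge_multi_at_top[of "Suc k"]] bound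
          in \<open>auto elim!: eventually_mono simp: Suc_le_eq\<close>)
  qed
  ultimately show ?thesis
    using that by blast
qed

section \<open>Order statistics and linear splines\<close>

text \<open>In a sorted list the entries not exceeding \<open>u\<close> form an initial segment, so
  their number decides on which side of \<open>u\<close> position \<open>k\<close> lies. Together
  with \<open>sorted_nth_gt\<close> this translates counts into bounds on order statistics.\<close>

lemma sorted_nth_le:
  assumes "sorted xs" "k < length (filter (\<lambda>v. v \<le> u) xs)"
  shows "xs ! k \<le> u"
proof (rule ccontr)
  assume k: "\<not> xs ! k \<le> u"
  have "{i. i < length xs \<and> xs ! i \<le> u} \<subseteq> {..<k}"
    using k sorted_nth_mono[OF assms(1)] by (fastforce simp: not_le)
  then have "length (filter (\<lambda>v. v \<le> u) xs) \<le> k"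
    unfolding length_filter_conv_card by (metis card_lessThan card_mono finite_lessThan)
  with assms(2) show False by simp
qed

lemma sorted_nth_gt:
  assumes "sorted xs" "length (filter (\<lambda>v. v \<le> u) xs) \<le> k" "k < length xs"
  shows "u < xs ! k"
proof (rule ccontr)
  assume k: "\<not> u < xs ! k"
  have "{..k} \<subseteq> {i. i < length xs \<and> xs ! i \<le> u}"
    using k sorted_nth_mono[OF assms(1)] assms(3) by (fastforce simp: not_less)
  then have "Suc k \<le> length (filter (\<lambda>v. v \<le> u) xs)"
    unfolding length_filter_conv_card by (metis (no_types, lifting) card_atMost card_mono finite_nat_set_iff_bounded mem_Collect_eq)
  with assms(2) show False by simp
qed

text \<open>The piece over these two nodes is affine with nondecreasing end values, so its slope is
  nonnegative.\<close>

lemma linear_spline_between_nodes: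
  assumes "is_linear_spline w s g" "i < w" "s i \<le> s (Suc i)" "y \<in> {real i / real w..real (i + 1) / real w}"
  shows "s i \<le> g y" "g y \<le> s (Suc i)"
proof -
  let ?l = "real i / real w" and ?r = "real (i + 1) / real w"
  obtain m c where g: "\<And>z. z \<in> {?l..?r} \<Longrightarrow> g z = m * z + c"
    using assms(1,2) unfolding is_linear_spline_def by blast
  have lr: "?l < ?r"
    using assms(2) by (simp add: divide_strict_right_mono)
  have "g ?l = s i" "g ?r = s (Suc i)"
    using assms(1,2) unfolding is_linear_spline_def by (metis Suc_eq_plus1 Suc_leI less_imp_le)+
  then have s: "s i = m * ?l + c" "s (Suc i) = m * ?r + c"
    using g[of ?l] g[of ?r] lr by auto
  have "m * ?l \<le> m * ?r"
    using assms(3) s by simp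
  then have m: "m \<ge> 0"
    using lr by (meson mult_less_cancel_left not_less)
  show "s i \<le> g y" "g y \<le> s (Suc i)"
    using assms(4) mult_left_mono[OF _ m, of ?l y] mult_left_mono[OF _ m, of y ?r]
    unfolding s g[OF assms(4)] by auto
qed

text \<open>\<open>F n y\<close> lies between two consecutive order statistics whose positions
  differ from \<open>y\<close> times the sample size by a bounded amount. For rational
  \<open>u < q\<close> the proportion of samples up to \<open>u\<close> tends to a limit less than
  \<open>y\<close>, so these order statistics eventually exceed \<open>u\<close>. The case
  \<open>u > q\<close> is symmetric.\<close>

lemma linear_spline_tendsto_quantile:
  fixes xs :: "'n \<Rightarrow> real list" and F :: "'n \<Rightarrow> real \<Rightarrow> real" and G :: "real \<Rightarrow> real"
  assumes sorted: "\<And>n. sorted (xs n)"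
    and len: "filterlim (\<lambda>n. real (length (xs n))) at_top \<F>"
    and emp: "\<And>u. u \<in> \<rat> \<Longrightarrow>
      ((\<lambda>n. real (length (filter (\<lambda>v. v \<le> u) (xs n))) / real (length (xs n))) \<longlongrightarrow> G u) \<F>"
    and spline: "\<forall>\<^sub>F n in \<F>. is_linear_spline (length (xs n) - 1) (\<lambda>i. xs n ! i) (F n)"
    and y: "0 < y" "y < 1" and below: "\<And>u. u < q \<Longrightarrow> G u < y" and above: "\<And>u. u > q \<Longrightarrow> G u > y"
  shows "((\<lambda>n. F n y) \<longlongrightarrow> q) \<F>"
proof -
  let ?L = "\<lambda>n. real (length (xs n))"
  let ?c = "\<lambda>u n. length (filter (\<lambda>v. v \<le> u) (xs n))"
  have large: "\<forall>\<^sub>F n in \<F>. K \<le> ?L n" for K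
    using len unfolding filterlim_at_top by blast
  have node: "\<exists>i. Suc i < length (xs n) \<and> real i \<le> y * ?L n \<and> y * ?L n < real i + 2 \<and>
      xs n ! i \<le> F n y \<and> F n y \<le> xs n ! Suc i"
    if L: "2 \<le> ?L n" and sp: "is_linear_spline (length (xs n) - 1) (\<lambda>i. xs n ! i) (F n)" for n
  proof -
    define w where "w = length (xs n) - 1"
    have w: "w > 0" "real w = ?L n - 1"
      using L by (auto simp: w_def)
    define i where "i = nat \<lfloor>y * real w\<rfloor>"
    have yw: "0 \<le> y * real w" "y * real w < real w"
      using y w by auto
    have i: "real i \<le> y * real w" "y * real w < real i + 1"
      using yw by (auto simp: i_def)
    have "i < w"
      using i yw by linarith
    moreover have "y \<in> {real i / real w..real (i + 1) / real w}"
      using i w(1) by (auto simp: field_simps)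
    moreover have "xs n ! i \<le> xs n ! Suc i"
      using \<open>i < w\<close> by (intro sorted_nth_mono[OF sorted]) (auto simp: w_def)
    ultimately have "xs n ! i \<le> F n y \<and> F n y \<le> xs n ! Suc i"
      using linear_spline_between_nodes[OF sp[folded w_def], of i y] by simp
    \<comment> \<open>The nodes are spaced by the inverse of the length minus one. Passing from
      \<open>y * real w\<close> to \<open>y * ?L n\<close> adds \<open>y < 1\<close>, which turns
      the bound \<open>real i + 1\<close> into \<open>real i + 2\<close>.\<close>
    moreover have "real i \<le> y * ?L n" "y * ?L n < real i + 2"
      using i y unfolding w(2) by (auto simp: algebra_simps)
    ultimately show ?thesis
      using \<open>i < w\<close> by (intro exI[of _ i]) (auto simp: w_def)
  qed
  show ?thesis
  proof (rule order_tendstoI)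
    fix e assume "e < q"
    then obtain u where u: "e < u" "u < q" "u \<in> \<rat>"
      using Rats_dense_in_real by blast
    \<comment> \<open>Half of the gap absorbs the error of the empirical proportion; the other half,
      once \<open>d * ?L n\<close> is at least 2, absorbs the shift by two positions.\<close>
    define d where "d = (y - G u) / 2"
    have d: "d > 0" "G u < y - d"
      using below[OF u(2)] by (auto simp: d_def field_simps)
    have "\<forall>\<^sub>F n in \<F>. real (?c u n) / ?L n < y - d"
      using order_tendstoD(2)[OF emp[OF u(3)] d(2)] .
    with spline large[of "max 2 (2 / d)"] show "\<forall>\<^sub>F n in \<F>. e < F n y"
    proof eventually_elim
      case (elim n)
      then obtain i where i: "Suc i < length (xs n)" "y * ?L n < real i + 2" "xs n ! i \<le> F n y"
        using node[of n] by auto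
      have L: "?L n \<ge> 2" "?L n \<ge> 2 / d"
        using elim(2) by auto
      then have "2 \<le> d * ?L n"
        using d(1) by (simp add: field_simps)
      moreover have "real (?c u n) < (y - d) * ?L n"
        using elim(3) L(1) by (subst (asm) pos_divide_less_eq) auto
      ultimately have "?c u n \<le> i"
        using i(2) by (simp add: algebra_simps)
      then have "u < xs n ! i"
        using sorted_nth_gt[OF sorted] i(1) by simp
      with u(1) i(3) show ?case by simp
    qed
  next
    fix e assume "q < e"
    then obtain u where u: "q < u" "u < e" "u \<in> \<rat>"
      using Rats_dense_in_real by blast
    define d where "d = (G u - y) / 2"
    have d: "d > 0" "y + d < G u"
      using above[OF u(1)] by (auto simp: d_def field_simps)
    have "\<forall>\<^sub>F n in \<F>. y + d < real (?c u n) / ?L n"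
      using order_tendstoD(1)[OF emp[OF u(3)] d(2)] .
    with spline large[of "max 2 (2 / d)"] show "\<forall>\<^sub>F n in \<F>. F n y < e"
    proof eventually_elim
      case (elim n)
      then obtain i where i: "real i \<le> y * ?L n" "F n y \<le> xs n ! Suc i"
        using node[of n] by auto
      have L: "?L n \<ge> 2" "?L n \<ge> 2 / d"
        using elim(2) by auto
      then have "2 \<le> d * ?L n"
        using d(1) by (simp add: field_simps)
      moreover have "(y + d) * ?L n < real (?c u n)"
        using elim(3) L(1) by (subst (asm) pos_less_divide_eq) auto
      ultimately have "Suc i < ?c u n"
        using i(1) by (simp add: algebra_simps)
      then have "xs n ! Suc i \<le> u"
        using sorted_nth_le[OF sorted] by simp
      with u(2) i(2) show ?case by simp
    qed
  qed
qed

section \<open>Generalized inverse of a monotone function\<close>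

text \<open>The first strict inequality is immediate from the infimum. The second can fail only
  where \<open>G\<close> stays at the value \<open>y\<close> to the right of \<open>q y\<close>;
  there \<open>q\<close> jumps, and a monotone function has at most countably many jumps.\<close>

lemma AE_quantile_strict:
  fixes G :: "real \<Rightarrow> real"
  defines "q \<equiv> \<lambda>y. Inf {u. y \<le> G u}"
  assumes "mono G" and small: "\<And>y. 0 < y \<Longrightarrow> \<exists>u. G u < y" and large: "\<And>y. y < 1 \<Longrightarrow> \<exists>u. y \<le> G u"
  shows "AE y in lebesgue_on {0<..<1}. (\<forall>u<q y. G u < y) \<and> (\<forall>u>q y. y < G u)"
proof -
  have bdd: "bdd_below {u. y \<le> G u}" if "0 < y" for y
  proof -
    from small[OF that] obtain u where "G u < y"
      by blast
    then have "u \<le> v" if "y \<le> G v" for v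
      using monoD[OF \<open>mono G\<close>, of v u] that by (cases "u \<le> v") auto
    then show ?thesis
      by (auto simp: bdd_below_def)
  qed
  \<comment> \<open>Raising \<open>y\<close> shrinks the set under the infimum. The assumptions
    \<open>small\<close> and \<open>large\<close> keep it bounded below and nonempty for
    \<open>y\<close> in the open unit interval.\<close>
  have "mono_on {0<..<1} q"
    unfolding q_def using bdd large by (intro mono_onI cInf_superset_mono) auto
  then have count: "countable {y \<in> {0<..<1}. \<not> isCont q y}"
    by (intro mono_on_ctble_discont_open) auto
  have "(\<forall>u<q y. G u < y) \<and> (\<forall>u>q y. y < G u)" if y: "0 < y" "y < 1" and cont: "isCont q y" for y
  proof safe
    fix u assume "u < q y"
    then show "G u < y"
      using cInf_lower[OF _ bdd[OF y(1)], of u] unfolding q_def by (metis leD leI mem_Collect_eq)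
  next
    fix u assume "u > q y"
    with cont have "\<forall>\<^sub>F z in at y. q z < u"
      by (auto simp: isCont_def intro: order_tendstoD)
    then have "\<forall>\<^sub>F z in at_right y. q z < u"
      by (simp add: eventually_at_split)
    moreover have "\<forall>\<^sub>F z in at_right y. y < z \<and> z < 1"
      using eventually_at_right_real[OF y(2)] by simp
    ultimately have "\<forall>\<^sub>F z in at_right y. q z < u \<and> y < z \<and> z < 1"
      by eventually_elim auto
    \<comment> \<open>Continuity gives a level \<open>z\<close> slightly above \<open>y\<close> with
      \<open>q z < u\<close>; a point \<open>v < u\<close> with \<open>z \<le> G v\<close> then
      forces \<open>y < z \<le> G u\<close>.\<close>
    then obtain z where z: "q z < u" "y < z" "z < 1"
      using eventually_happens'[OF trivial_limit_at_right_real] by blast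
    obtain v where "z \<le> G v" "v < u"
      using z(1) large[OF z(3)] bdd[of z] y(1) z(2) unfolding q_def by (subst (asm) cInf_less_iff) auto
    then show "y < G u"
      using monoD[OF \<open>mono G\<close>, of v u] z(2) by auto
  qed
  moreover have "{y \<in> {0<..<1}. \<not> isCont q y} \<in> null_sets lebesgue"
    using countable_imp_null_set_lborel[OF count] by (simp add: null_sets_completionI)
  then have "AE y in lebesgue. y \<in> {0<..<1} \<longrightarrow> isCont q y"
    by (rule AE_I') auto
  ultimately show ?thesis
    by (subst AE_restrict_space_iff) (auto elim!: eventually_mono)
qed

section \<open>Counting in the sorted samples\<close>

lemma sorted_sorted_samples: "sorted (sorted_samples \<Omega> f x n)"
  by (simp add: sorted_samples_def)

lemma finite_grid_indices_in [simp]: "finite (grid_indices_in \<Omega> x n)"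
  by (rule finite_subset[OF _ finite_multi_index_range[of n]]) (auto simp: grid_indices_in_def)

text \<open>Sorting preserves the multiset, so counts in the sorted list become counts of grid
  points, to which equidistribution applies.\<close>

lemma length_filter_sorted_samples:
  "length (filter P (sorted_samples \<Omega> f x n)) = card {i \<in> grid_indices_in \<Omega> x n. P (f (x n i))}"
proof -
  have "length (filter P (sorted_samples \<Omega> f x n)) = size (filter_mset P (mset (sorted_samples \<Omega> f x n)))"
    by (metis mset_filter size_mset)
  then show ?thesis
    by (simp add: sorted_samples_def filter_mset_image_mset)
qed

lemma length_sorted_samples: "length (sorted_samples \<Omega> f x n) = card (grid_indices_in \<Omega> x n)"
  using length_filter_sorted_samples[of "\<lambda>_. True" \<Omega> f x n] by simp

section \<open>Sublevel sets and the distribution function\<close>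

context
  fixes M :: "'a measure" and \<Omega> :: "'a set" and f :: "'a \<Rightarrow> real"
  assumes \<Omega>: "\<Omega> \<in> fmeasurable M" and f: "f \<in> borel_measurable (restrict_space M \<Omega>)"
begin

lemma fmeasurable_sublevel: "{x \<in> \<Omega>. f x \<le> u} \<in> fmeasurable M"
proof -
  have sp: "\<Omega> \<subseteq> space M"
    using \<Omega> by (simp add: fmeasurableD sets.sets_into_space)
  have "{x \<in> space (restrict_space M \<Omega>). f x \<le> u} \<in> sets (restrict_space M \<Omega>)"
    using f by measurable
  then have "{x \<in> \<Omega>. f x \<le> u} \<in> sets M"
    using \<Omega> sp by (simp add: sets_restrict_space_iff space_restrict_space Int_absorb2 Int_absorb1 fmeasurableD)
  then show ?thesis
    by (rule fmeasurableI2[OF \<Omega>, rotated]) auto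
qed

lemma mono_measure_sublevel: "mono (\<lambda>u. measure M {x \<in> \<Omega>. f x \<le> u})"
  using fmeasurable_sublevel by (intro monoI measure_mono_fmeasurable) auto

text \<open>\<open>f\<close> takes real values, so these sublevel sets decrease to the empty set,
  and finite measure permits continuity from above. This supplies the assumption
  \<open>small\<close> of \<open>AE_quantile_strict\<close>.\<close>

lemma measure_sublevel_tendsto_0: "(\<lambda>k. measure M {x \<in> \<Omega>. f x \<le> - real k}) \<longlonglongrightarrow> 0"
proof -
  have "(\<lambda>k. measure M {x \<in> \<Omega>. f x \<le> - real k}) \<longlonglongrightarrow> measure M (\<Inter>k. {x \<in> \<Omega>. f x \<le> - real k})"
  proof (rule Lim_measure_decseq)
    show "decseq (\<lambda>k. {x \<in> \<Omega>. f x \<le> - real k})"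
      by (auto simp: decseq_def)
    show "emeasure M {x \<in> \<Omega>. f x \<le> - real k} \<noteq> \<infinity>" for k
      using fmeasurableD2[OF fmeasurable_sublevel] by simp
  qed (use fmeasurable_sublevel in \<open>auto simp: fmeasurableD\<close>)
  also have "(\<Inter>k. {x \<in> \<Omega>. f x \<le> - real k}) = {}"
  proof -
    have "\<exists>k. \<not> f x \<le> - real k" for x
      using reals_Archimedean2[of "- f x"] by (auto simp: not_le minus_less_iff)
    then show ?thesis by blast
  qed
  finally show ?thesis by simp
qed

lemma measure_sublevel_tendsto_measure: "(\<lambda>k. measure M {x \<in> \<Omega>. f x \<le> real k}) \<longlonglongrightarrow> measure M \<Omega>"
proof -
  have eq: "(\<Union>k. {x \<in> \<Omega>. f x \<le> real k}) = \<Omega>"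
    using real_arch_simple by auto
  have "(\<lambda>k. measure M {x \<in> \<Omega>. f x \<le> real k}) \<longlonglongrightarrow> measure M (\<Union>k. {x \<in> \<Omega>. f x \<le> real k})"
  proof (rule Lim_measure_incseq)
    show "incseq (\<lambda>k. {x \<in> \<Omega>. f x \<le> real k})"
      by (auto simp: incseq_def)
  qed (use fmeasurable_sublevel fmeasurableD2[OF \<Omega>] in \<open>auto simp: eq fmeasurableD\<close>)
  then show ?thesis
    unfolding eq .
qed

end

section \<open>Almost everywhere convergence of the splines\<close>

theorem theorem4p1:
  fixes \<Omega> :: "(real ^ 'd) set" and f :: "real ^ 'd \<Rightarrow> real" and a b :: "real ^ 'd"
  assumes "regular_set \<Omega>"
    and "measure lebesgue \<Omega> > 0"
    and "f \<in> borel_measurable (lebesgue_on \<Omega>)"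
    and "a \<le> b"
    and "\<Omega> \<subseteq> cbox a b"
  shows "\<exists>x :: nat ^ 'd \<Rightarrow> nat ^ 'd \<Rightarrow> real ^ 'd.
    asymptotically_uniform a b x \<and>
    (\<forall>F :: nat ^ 'd \<Rightarrow> real \<Rightarrow> real.
      (\<forall>n. 1 \<le> n \<and> grid_omega \<Omega> x n \<ge> 1 \<longrightarrow>
        is_linear_spline (grid_omega \<Omega> x n) (\<lambda>i. sorted_samples \<Omega> f x n ! i) (F n)) \<longrightarrow>
      (AE y in lebesgue_on {0<..<1}.
        ((\<lambda>n. F n y) \<longlongrightarrow> monotone_rearrangement \<Omega> f y) multi_at_top))"
proof -
  let ?\<mu> = "measure lebesgue" and ?V = "measure lebesgue (cbox a b)"
  \<comment> \<open>\<open>measure\<close> takes the default value 0 on sets that are not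
    measurable, so positive measure forces measurability.\<close>
  have "\<Omega> \<in> sets lebesgue"
    using assms(2) measure_notin_sets by fastforce
  then have \<Omega>: "\<Omega> \<in> lmeasurable"
    using assms(5) by (metis bounded_cbox bounded_set_imp_lmeasurable bounded_subset)
  note sub = fmeasurable_sublevel[OF \<Omega> assms(3)]
  have V: "?V > 0"
    using assms(2) measure_mono_fmeasurable[OF assms(5) \<open>\<Omega> \<in> sets lebesgue\<close>] by simp
  \<comment> \<open>A degenerate side would give the rectangle volume 0, although it contains a set
    of positive measure.\<close>
  have ab: "a $ j < b $ j" for j
  proof (rule ccontr)
    assume "\<not> a $ j < b $ j"
    then have "\<exists>j\<in>UNIV. b $ j - a $ j = 0"
      using assms(4) by (auto simp: less_eq_vec_def intro!: exI[of _ j] antisym)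
    then have "?V = 0"
      by (simp add: content_cbox_if_cart)
    with V show False by simp
  qed
  \<comment> \<open>Countably many sets are enough: index 0 controls the sample size, and index
    \<open>Suc r\<close> the sublevel set at the rational coded by \<open>r\<close>.\<close>
  define A where "A k = (case k of 0 \<Rightarrow> \<Omega> | Suc r \<Rightarrow> {x \<in> \<Omega>. f x \<le> of_rat (from_nat r)})" for k
  have "A k \<in> sets lebesgue" "A k \<subseteq> cbox a b" for k
    using sub \<open>\<Omega> \<in> sets lebesgue\<close> assms(5) by (auto simp: A_def fmeasurableD split: nat.split)
  then obtain x where unif: "asymptotically_uniform a b x"
    and equi: "\<And>k. ((\<lambda>n. real (card {i. 1 \<le> i \<and> i \<le> n \<and> x n i \<in> A k}) / real (card {i :: nat ^ 'd. 1 \<le> i \<and> i \<le> n}))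
           \<longlongrightarrow> ?\<mu> (A k) / ?V) multi_at_top"
    using exists_equidistributed_grid[OF ab] by blast
  let ?N = "\<lambda>n. real (card {i :: nat ^ 'd. 1 \<le> i \<and> i \<le> n})"
  let ?xs = "sorted_samples \<Omega> f x"
  let ?c = "\<lambda>u n. real (length (filter (\<lambda>v. v \<le> u) (?xs n)))"
  define G where "G u = ?\<mu> {x \<in> \<Omega>. f x \<le> u} / ?\<mu> \<Omega>" for u
  have N_top: "filterlim ?N at_top multi_at_top"
    using filterlim_compose[OF filterlim_real_sequentially filterlim_card_multi_index] .
  have len: "((\<lambda>n. real (length (?xs n)) / ?N n) \<longlongrightarrow> ?\<mu> \<Omega> / ?V) multi_at_top"
    using equi[of 0] by (simp add: A_def length_sorted_samples grid_indices_in_def)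
  have cnt: "((\<lambda>n. ?c u n / ?N n) \<longlongrightarrow> ?\<mu> {x \<in> \<Omega>. f x \<le> u} / ?V) multi_at_top" if "u \<in> \<rat>" for u
  proof -
    from that obtain r where u: "u = of_rat r"
      by (rule Rats_cases)
    have "{i. 1 \<le> i \<and> i \<le> n \<and> x n i \<in> A (Suc (to_nat r))} = {i \<in> grid_indices_in \<Omega> x n. f (x n i) \<le> u}" for n
      by (auto simp: A_def u grid_indices_in_def)
    then show ?thesis
      using equi[of "Suc (to_nat r)"] by (simp add: A_def length_filter_sorted_samples u)
  qed
  \<comment> \<open>The sample size is asymptotically a positive multiple of the number of grid
    points.\<close>
  have len_top: "filterlim (\<lambda>n. real (length (?xs n))) at_top multi_at_top"
  proof -
    have mult_cancel: "l / m * m = l" if "0 < m" for l m :: real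
      using that by simp
    have "filterlim (\<lambda>n. real (length (?xs n)) / ?N n * ?N n) at_top multi_at_top"
      using assms(2) V by (intro filterlim_tendsto_pos_mult_at_top[OF len _ N_top]) simp
    moreover have "\<forall>\<^sub>F n in multi_at_top. real (length (?xs n)) / ?N n * ?N n = real (length (?xs n))"
      using N_top[unfolded filterlim_at_top_dense, rule_format, of 0]
      by (rule eventually_mono) (rule mult_cancel)
    ultimately show ?thesis
      by (simp cong: filterlim_cong)
  qed
  have emp: "((\<lambda>n. ?c u n / real (length (?xs n))) \<longlongrightarrow> G u) multi_at_top" if "u \<in> \<rat>" for u
  proof -
    have div_cancel: "(c / m) / (l / m) = c / l" if "0 < m" for c l m :: real
      using that by simp
    have "((\<lambda>n. (?c u n / ?N n) / (real (length (?xs n)) / ?N n)) \<longlongrightarrow>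
        (?\<mu> {x \<in> \<Omega>. f x \<le> u} / ?V) / (?\<mu> \<Omega> / ?V)) multi_at_top"
      using assms(2) V by (intro tendsto_divide cnt[OF that] len) simp
    moreover have "(?\<mu> {x \<in> \<Omega>. f x \<le> u} / ?V) / (?\<mu> \<Omega> / ?V) = G u"
      using V by (simp add: G_def)
    moreover have "\<forall>\<^sub>F n in multi_at_top.
        (?c u n / ?N n) / (real (length (?xs n)) / ?N n) = ?c u n / real (length (?xs n))"
      using N_top[unfolded filterlim_at_top_dense, rule_format, of 0]
      by (rule eventually_mono) (rule div_cancel)
    ultimately show ?thesis
      by (simp only: tendsto_cong)
  qed
  have "mono G"
    using mono_measure_sublevel[OF \<Omega> assms(3)] assms(2) by (auto simp: G_def mono_def divide_right_mono)
  moreover have "\<exists>u. G u < y" if "0 < y" for y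
  proof -
    have "(\<lambda>k. G (- real k)) \<longlonglongrightarrow> 0"
      unfolding G_def by (rule tendsto_divide_zero[OF measure_sublevel_tendsto_0[OF \<Omega> assms(3)]])
    from order_tendstoD(2)[OF this that] show ?thesis
      by (auto simp: eventually_sequentially)
  qed
  moreover have "\<exists>u. y \<le> G u" if "y < 1" for y
  proof -
    have "(\<lambda>k. G (real k)) \<longlonglongrightarrow> ?\<mu> \<Omega> / ?\<mu> \<Omega>"
      unfolding G_def using assms(2)
      by (intro tendsto_divide measure_sublevel_tendsto_measure[OF \<Omega> assms(3)] tendsto_const) simp
    then have "(\<lambda>k. G (real k)) \<longlonglongrightarrow> 1"
      using assms(2) by simp
    from order_tendstoD(1)[OF this that] show ?thesis
      by (auto simp: eventually_sequentially intro: less_imp_le)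
  qed
  ultimately have "AE y in lebesgue_on {0<..<1}.
      (\<forall>u<Inf {u. y \<le> G u}. G u < y) \<and> (\<forall>u>Inf {u. y \<le> G u}. y < G u)"
    by (rule AE_quantile_strict)
  moreover have "Inf {u. y \<le> G u} = monotone_rearrangement \<Omega> f y" for y
    by (simp add: monotone_rearrangement_def G_def)
  ultimately have q: "AE y in lebesgue_on {0<..<1}. (\<forall>u<monotone_rearrangement \<Omega> f y. G u < y) \<and>
      (\<forall>u>monotone_rearrangement \<Omega> f y. y < G u)"
    by simp
  show ?thesis
  proof (intro exI conjI allI impI)
    show "asymptotically_uniform a b x"
      by (rule unif)
    fix F :: "nat ^ 'd \<Rightarrow> real \<Rightarrow> real"
    assume F: "\<forall>n. 1 \<le> n \<and> 1 \<le> grid_omega \<Omega> x n \<longrightarrow>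
      is_linear_spline (grid_omega \<Omega> x n) (\<lambda>i. ?xs n ! i) (F n)"
    \<comment> \<open>The assumption on \<open>F\<close> applies only if \<open>n\<close> is at
      least 1 and there are two or more samples; the filter eventually guarantees both.\<close>
    have spline: "\<forall>\<^sub>F n in multi_at_top. is_linear_spline (length (?xs n) - 1) (\<lambda>i. ?xs n ! i) (F n)"
      using eventually_ge_1_multi_at_top len_top[unfolded filterlim_at_top_dense, rule_format, of 1]
    proof eventually_elim
      case (elim n)
      then show ?case
        using F by (auto simp: less_eq_vec_def grid_omega_def length_sorted_samples)
    qed
    have "AE y in lebesgue_on {0<..<1}. y \<in> {0<..<1 :: real}"
      by (rule AE_I2) (simp add: space_restrict_space)
    with q show "AE y in lebesgue_on {0<..<1}. ((\<lambda>n. F n y) \<longlongrightarrow> monotone_rearrangement \<Omega> f y) multi_at_top"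
    proof eventually_elim
      case (elim y)
      show ?case
        by (rule linear_spline_tendsto_quantile[OF sorted_sorted_samples len_top emp spline]) (use elim in auto)
    qed
  qed
qed

end
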